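(* For the finite volume method for the one-dimensional compressible Euler equations with gravity, the source term $S^{\varrho v}$ preserves the hydrostatic balance prescribed by a constant background potential temperature $\theta$ if the source term is of the form $$S^{\varrho v}=\{\!\{\varrho\}\!\}_{\gamma}\,[\![\phi]\!]$$ and the pressure term is discretized as $\{\!\{p\}\!\}$.
   Context: At rest ($v=0$) the momentum equation $\partial_t(\varrho v)+\partial_x(\varrho v^2+p)=-\varrho\,\partial_x\phi$ reduces to $\partial_xp=-\varrho\,\partial_x\phi$, where $\phi=\phi(x)$ is a given time-independent geopotential. Here $p=K(\varrho\theta)^\gamma$ with constants $K>0$, $\gamma>1$. For constant $\theta>0$ the balance reads $K\theta^\gamma\partial_x\varrho^\gamma=-\varrho\,\partial_x\phi$, with solution given by $\frac1{\gamma-1}(\varrho^{\gamma-1}-\varrho_0^{\gamma-1})=-\frac1{K\gamma\theta^\gamma}(\phi-\phi_0)$, where $\varrho_0,\phi_0$ are the values at $x=0$. At the interface $i+\frac12$ between cells $i$ and $i+1$: $[\![a]\!]_{i+1/2}=a_{i+1}-a_i$, $\{\!\{a\}\!\}_{i+1/2}=(a_i+a_{i+1})/2$, $\{\!\{a\}\!\}_\gamma=\frac{\gamma-1}\gamma\frac{[\![a^\gamma]\!]}{[\![a^{\gamma-1}]\!]}$ for positive values (equal to $a$ if both values equal $a$). The momentum part of the finite volume method is $\partial_t(\varrho v)_i=-\frac{f^{\varrho v}_{i+1/2}-f^{\varrho v}_{i-1/2}}{\Delta x}-\frac{S^{\varrho v}_{i+1/2}+S^{\varrho v}_{i-1/2}}{2\Delta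 x}$, and "the pressure term is discretized as $\{\!\{p\}\!\}$" means that for states at rest $f^{\varrho v}_{i+1/2}=\{\!\{p\}\!\}_{i+1/2}$. Preserving the hydrostatic balance means that for grid data with $v_i=0$, $\varrho_i>0$ satisfying $\frac1{\gamma-1}(\varrho_i^{\gamma-1}-\varrho_0^{\gamma-1})=-\frac1{K\gamma\theta^\gamma}(\phi_i-\phi_0)$ and $p_i=K(\varrho_i\theta)^\gamma$, the momentum right-hand side vanishes for all $i$: $$\frac{\{\!\{p\}\!\}_{i+1/2}-\{\!\{p\}\!\}_{i-1/2}}{\Delta x}+\frac{S^{\varrho v}_{i+1/2}+S^{\varrho v}_{i-1/2}}{2\Delta x}=0.$$ Only the momentum equation is involved; the choice of the remaining thermodynamic variable ($\varrho E$ or $\varrho\theta$) is irrelevant. *)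

theory Defs
  imports Complex_Main
begin

text \<open>
  Cells are indexed by the integers.  A quantity living at the interface between the cells
  \<open>i\<close> and \<open>i + 1\<close> (the interface \<open>i + 1/2\<close>) is indexed by \<open>i\<close>, so the value at \<open>i - 1/2\<close> is
  the one with index \<open>i - 1\<close>.
\<close>

definition jump :: "(int \<Rightarrow> real) \<Rightarrow> int \<Rightarrow> real" where
  "jump a i = a (i + 1) - a i"

definition avg :: "(int \<Rightarrow> real) \<Rightarrow> int \<Rightarrow> real" where
  "avg a i = (a i + a (i + 1)) / 2"

definition gamma_mean :: "real \<Rightarrow> (int \<Rightarrow> real) \<Rightarrow> int \<Rightarrow> real" where
  "gamma_mean \<gamma> a i =
     (if a i = a (i + 1) then a i
      else (\<gamma> - 1) / \<gamma> * (jump (\<lambda>j. a j powr \<gamma>) i / jump (\<lambda>j. a j powr (\<gamma> - 1)) i))"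

text \<open>
  Using the pressure as the third variable of a grid state keeps the description independent of
  whether the scheme evolves \<open>\<rho>E\<close> or \<open>\<rho>\<theta>\<close>.
\<close>

record grid_state =
  dens :: "int \<Rightarrow> real"
  vel :: "int \<Rightarrow> real"
  pres :: "int \<Rightarrow> real"

definition admissible :: "grid_state \<Rightarrow> bool" where
  "admissible U \<longleftrightarrow> (\<forall>i. dens U i > 0 \<and> pres U i > 0)"

definition at_rest :: "grid_state \<Rightarrow> bool" where
  "at_rest U \<longleftrightarrow> (\<forall>i. vel U i = 0)"

text \<open>
  The numerical momentum flux \<open>f\<close> and the source term \<open>S\<close> are interface quantities which may
  depend on the whole grid state; the time-independent geopotential is fixed.
\<close>

type_synonym interface_fun = "grid_state \<Rightarrow> int \<Rightarrow> real"

definition momentum_rhs :: "real \<Rightarrow> interface_fun \<Rightarrow> interface_fun \<Rightarrow> grid_state \<Rightarrow> int \<Rightarrow> real" where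
  "momentum_rhs \<Delta>x f S U i =
     - ((f U i - f U (i - 1)) / \<Delta>x) - (S U i + S U (i - 1)) / (2 * \<Delta>x)"

text \<open>The pressure term is discretized as \<open>{{p}}\<close>; for \<open>v \<noteq> 0\<close> the flux is unconstrained.\<close>

definition pressure_term_avg :: "interface_fun \<Rightarrow> bool" where
  "pressure_term_avg f \<longleftrightarrow>
     (\<forall>U. admissible U \<longrightarrow> at_rest U \<longrightarrow> (\<forall>i. f U i = avg (pres U) i))"

definition source_term_gamma_mean :: "real \<Rightarrow> (int \<Rightarrow> real) \<Rightarrow> interface_fun \<Rightarrow> bool" where
  "source_term_gamma_mean \<gamma> \<phi> S \<longleftrightarrow>
     (\<forall>U. admissible U \<longrightarrow> (\<forall>i. S U i = gamma_mean \<gamma> (dens U) i * jump \<phi> i))"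

text \<open>
  \<open>\<rho>0\<close> and \<open>\<phi>0\<close> are the reference values at \<open>x = 0\<close>; they need not be values in a cell
  (\<open>x = 0\<close> may be an interface).
\<close>

definition hydrostatic_state ::
    "real \<Rightarrow> real \<Rightarrow> real \<Rightarrow> (int \<Rightarrow> real) \<Rightarrow> real \<Rightarrow> real \<Rightarrow> grid_state \<Rightarrow> bool" where
  "hydrostatic_state K \<gamma> \<theta> \<phi> \<rho>0 \<phi>0 U \<longleftrightarrow>
     at_rest U \<and>
     (\<forall>i. dens U i > 0 \<and>
          1 / (\<gamma> - 1) * (dens U i powr (\<gamma> - 1) - \<rho>0 powr (\<gamma> - 1))
            = - (1 / (K * \<gamma> * \<theta> powr \<gamma>)) * (\<phi> i - \<phi>0) \<and>
          pres U i = K * (dens U i * \<theta>) powr \<gamma>)"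

definition preserves_hydrostatic_balance ::
    "real \<Rightarrow> real \<Rightarrow> real \<Rightarrow> (int \<Rightarrow> real) \<Rightarrow> real \<Rightarrow> interface_fun \<Rightarrow> interface_fun \<Rightarrow> bool" where
  "preserves_hydrostatic_balance K \<gamma> \<theta> \<phi> \<Delta>x f S \<longleftrightarrow>
     (\<forall>\<rho>0 \<phi>0 U. \<rho>0 > 0 \<longrightarrow> hydrostatic_state K \<gamma> \<theta> \<phi> \<rho>0 \<phi>0 U \<longrightarrow>
        (\<forall>i. momentum_rhs \<Delta>x f S U i = 0))"

end

theory Submission
  imports Defs
begin

text \<open>
  The difference of two neighbouring averages of the pressure is half the sum of the two
  neighbouring jumps, so the momentum right-hand side is
  \<open>- (1 / (2 \<Delta>x))\<close> times the sum over the interfaces \<open>i + 1/2\<close> and \<open>i - 1/2\<close> of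
  \<open>jump p + S\<close>.  It therefore suffices that the source term balances the pressure jump at every
  single interface (\<open>source_balances_pressure_jump\<close>).  On a hydrostatic state,
  \<open>jump p = K \<theta>\<^sup>\<gamma> jump (\<rho>\<^sup>\<gamma>)\<close>, while taking the jump of the equilibrium relation gives
  \<open>jump \<phi> = - (K \<gamma> \<theta>\<^sup>\<gamma> / (\<gamma> - 1)) jump (\<rho>\<^bsup>\<gamma> - 1\<^esup>)\<close>.  The \<open>\<gamma>\<close>-mean is precisely the discrete chain rule
  factor with \<open>gamma_mean \<rho> * jump (\<rho>\<^bsup>\<gamma> - 1\<^esup>) = ((\<gamma> - 1) / \<gamma>) jump (\<rho>\<^sup>\<gamma>)\<close>
  (\<open>gamma_mean_mult_jump\<close>), and the three identities combine to
  \<open>gamma_mean \<rho> * jump \<phi> = - jump p\<close>.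
\<close>

text \<open>
  Discrete counterpart of \<open>\<rho> d(\<rho>\<^bsup>\<gamma> - 1\<^esup>) = ((\<gamma> - 1) / \<gamma>) d(\<rho>\<^sup>\<gamma>)\<close>.  If the two values differ, the
  quotient in the mean is genuine because \<open>x \<mapsto> x\<^bsup>\<gamma> - 1\<^esup>\<close> is injective on positive reals; if they
  agree, both sides vanish.
\<close>

lemma gamma_mean_mult_jump:
  assumes "\<gamma> \<noteq> 1" and "a i > 0" and "a (i + 1) > 0"
  shows "gamma_mean \<gamma> a i * jump (\<lambda>j. a j powr (\<gamma> - 1)) i
           = (\<gamma> - 1) / \<gamma> * jump (\<lambda>j. a j powr \<gamma>) i"
proof (cases "a i = a (i + 1)")
  case True
  then show ?thesis by (simp add: jump_def)
next
  case False
  have "a i powr (\<gamma> - 1) \<noteq> a (i + 1) powr (\<gamma> - 1)"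
  proof
    assume eq: "a i powr (\<gamma> - 1) = a (i + 1) powr (\<gamma> - 1)"
    have "a i = (a i powr (\<gamma> - 1)) powr (1 / (\<gamma> - 1))"
      using assms by (simp add: powr_powr)
    also have "\<dots> = a (i + 1)"
      unfolding eq using assms by (simp add: powr_powr)
    finally show False using False by contradiction
  qed
  then have "jump (\<lambda>j. a j powr (\<gamma> - 1)) i \<noteq> 0"
    by (simp add: jump_def)
  then show ?thesis
    using False by (simp add: gamma_mean_def)
qed

lemma momentum_rhs_pressure_jumps:
  assumes "\<And>j. f U j = avg p j" and "\<Delta>x \<noteq> 0"
  shows "momentum_rhs \<Delta>x f S U i
           = - ((jump p i + S U i) + (jump p (i - 1) + S U (i - 1))) / (2 * \<Delta>x)"
  using assms by (simp add: momentum_rhs_def avg_def jump_def field_simps)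

context
  fixes K \<gamma> \<theta> \<rho>0 \<phi>0 :: real and \<phi> :: "int \<Rightarrow> real" and U :: grid_state
  assumes pos: "K > 0" "\<gamma> > 1" "\<theta> > 0"
    and hyd: "hydrostatic_state K \<gamma> \<theta> \<phi> \<rho>0 \<phi>0 U"
begin

lemma hydrostatic_admissible: "admissible U"
proof -
  have dens: "dens U i > 0" and pres: "pres U i = K * (dens U i * \<theta>) powr \<gamma>" for i
    using hyd by (simp_all add: hydrostatic_state_def)
  have "dens U i * \<theta> > 0" for i
    using dens pos by simp
  then have "pres U i > 0" for i
    unfolding pres using pos by (metis mult_pos_pos powr_gt_zero less_irrefl)
  then show ?thesis
    using dens by (simp add: admissible_def)
qed

lemma hydrostatic_pressure_jump:
  "jump (pres U) i = K * \<theta> powr \<gamma> * jump (\<lambda>j. dens U j powr \<gamma>) i"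
proof -
  have "pres U j = K * \<theta> powr \<gamma> * dens U j powr \<gamma>" for j
    using hyd pos by (simp add: hydrostatic_state_def powr_mult less_imp_le)
  then show ?thesis by (simp add: jump_def right_diff_distrib)
qed

lemma hydrostatic_potential_jump:
  "jump \<phi> i = - (K * \<gamma> * \<theta> powr \<gamma> / (\<gamma> - 1)) * jump (\<lambda>j. dens U j powr (\<gamma> - 1)) i"
proof -
  define C where "C = K * \<gamma> * \<theta> powr \<gamma>"
  have "C > 0" using pos by (simp add: C_def)
  have "\<phi> j = \<phi>0 - C / (\<gamma> - 1) * (dens U j powr (\<gamma> - 1) - \<rho>0 powr (\<gamma> - 1))" for j
  proof -
    have "1 / (\<gamma> - 1) * (dens U j powr (\<gamma> - 1) - \<rho>0 powr (\<gamma> - 1)) = - (1 / C) * (\<phi> j - \<phi>0)"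
      using hyd by (simp add: hydrostatic_state_def C_def)
    from arg_cong[where f = "\<lambda>x. C * x", OF this] show ?thesis
      using \<open>C > 0\<close> by simp
  qed
  then show ?thesis
    unfolding C_def[symmetric] by (simp add: jump_def algebra_simps)
qed

lemma source_balances_pressure_jump:
  "gamma_mean \<gamma> (dens U) i * jump \<phi> i = - jump (pres U) i"
proof -
  have "gamma_mean \<gamma> (dens U) i * jump \<phi> i
          = - (K * \<gamma> * \<theta> powr \<gamma> / (\<gamma> - 1))
              * (gamma_mean \<gamma> (dens U) i * jump (\<lambda>j. dens U j powr (\<gamma> - 1)) i)"
    by (simp add: hydrostatic_potential_jump)
  also have "\<dots> = - (K * \<gamma> * \<theta> powr \<gamma> / (\<gamma> - 1))
                     * ((\<gamma> - 1) / \<gamma> * jump (\<lambda>j. dens U j powr \<gamma>) i)"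
    using pos hyd by (subst gamma_mean_mult_jump) (auto simp: hydrostatic_state_def)
  also have "\<dots> = - jump (pres U) i"
    using pos by (simp add: hydrostatic_pressure_jump)
  finally show ?thesis .
qed

end

theorem lemma4p5:
  fixes K \<gamma> \<theta> \<Delta>x :: real
    and \<phi> :: "int \<Rightarrow> real"
    and f S :: interface_fun
  assumes "K > 0" and "\<gamma> > 1" and "\<theta> > 0" and "\<Delta>x > 0"
    and "pressure_term_avg f"
    and "source_term_gamma_mean \<gamma> \<phi> S"
  shows "preserves_hydrostatic_balance K \<gamma> \<theta> \<phi> \<Delta>x f S"
  unfolding preserves_hydrostatic_balance_def
proof (intro allI impI)
  fix \<rho>0 \<phi>0 U i
  assume hyd: "hydrostatic_state K \<gamma> \<theta> \<phi> \<rho>0 \<phi>0 U"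
  have adm: "admissible U"
    using hydrostatic_admissible[OF assms(1-3) hyd] .
  have flux: "f U j = avg (pres U) j" for j
    using assms(5) adm hyd by (simp add: pressure_term_avg_def hydrostatic_state_def)
  have source: "S U j = - jump (pres U) j" for j
    using assms(6) adm source_balances_pressure_jump[OF assms(1-3) hyd]
    by (simp add: source_term_gamma_mean_def)
  show "momentum_rhs \<Delta>x f S U i = 0"
    using momentum_rhs_pressure_jumps[of f U "pres U", OF flux] source assms(4) by simp
qed

end
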